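(* Let $n\ge 2$, let $h$ be the euclidean metric on $\mathbb{R}^{n-1}$, and let ${\not\!\!D}^{res}_{N}(h;\lambda)$ be the residue family operators on spinors of the flat space $(\mathbb{R}^{n-1},h)$. Then for all $\lambda\in\mathbb{C}$ and $N\in\mathbb{N}_0$, \begin{align*} {\not\!\!D}^{res}_{2N}(h;\lambda)=(-1)^N\Big[&\sum_{j=0}^N a_j^{(N)}(\lambda-\tfrac12)\,D_{\mathcal T}^{2j}\,\iota^*D_{\mathcal N}^{2N-2j}\\ &+2N\sum_{j=0}^{N-1} b_j^{(N-1)}(\lambda-\tfrac12)\,D_{\mathcal T}^{2j+1}\,\iota^*D_{\mathcal N}^{2N-2j-1}\Big],\\ {\not\!\!D}^{res}_{2N+1}(h;\lambda)=(-1)^{N+1}e_n\cdot\Big[&\sum_{j=0}^N b_j^{(N)}(\lambda-\tfrac12)\,c^{(N)}(\lambda)\,D_{\mathcal T}^{2j}\,\iota^*D_{\mathcal N}^{2N-2j+1}\\ &-\sum_{j=0}^N a_j^{(N)}(\lambda-\tfrac12)\,D_{\mathcal T}^{2j+1}\,\iota^*D_{\mathcal N}^{2N-2j}\Big], \end{align*} where $c^{(N)}(\lambda):=2\lambda+n-2N-2$.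
   Context: Clifford and spinor conventions. $e_1,\dots,e_n$ is the standard basis of euclidean $\mathbb{R}^n$, with Clifford relations $e_i\cdot e_j+e_j\cdot e_i=-2\delta_{ij}$; $\Delta_n$ is the complex spinor module. Spinors on $\mathbb{R}^n_{x_n\ge 0}$ are smooth $\Delta_n$-valued functions. The boundary $\mathbb{R}^{n-1}=\{x_n=0\}$ carries the euclidean metric $h$; sections of the spinor bundle of $\mathbb{R}^n$ restricted to $\{x_n=0\}$ are smooth $\Delta_n$-valued functions on $\mathbb{R}^{n-1}$, and $\iota^*$ is the restriction of spinors to $x_n=0$. Put $$D_{\mathcal T}=\sum_{i=1}^{n-1}e_i\cdot\partial_i,\qquad D_{\mathcal N}=e_n\cdot\partial_n,\qquad \widetilde{\not\!\!D}=e_n\cdot\sum_{i=1}^{n-1}e_i\cdot\partial_i .$$ $D_{\mathcal T}$ and $\widetilde{\not\!\!D}$ act both on spinors on $\mathbb{R}^n_{x_n\ge0}$ and on $\Delta_n$-valued functions on $\mathbb{R}^{n-1}$. Pochhammer symbol: $(a)_l=a(a+1)\cdots(a+l-1)$, $(a)_0=1$. Solution operators of the flat space (the coefficients of formal asymptotic eigenspinors of the hyperbolic Dirac operator), rational in $\lambda$: for $l\in\mathbb{N}_0$, $$\mathcal T_{2l}(h;\lambda)=\frac{1}{2^{2l}\,l!\,(\frac12+\lambda)_l}\widetilde{\not\!\!D}^{2l},\qquad \mathcal T_{2l+1}(h;\lambda)=\frac{1}{2^{2l+1}\,l!\,(\frac12+\lambda)_{l+1}}\widetilde{\not\!\!D}^{2l+1}.$$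 Define, for $N\in\mathbb{N}_0$, $${\not\!\delta}_N(h;\lambda)=\sum_{j=0}^N\frac{1}{(N-j)!}\,\mathcal T_j(h;\lambda)\,\iota^*\partial_n^{N-j}.$$ Residue family operators (the boundary has dimension $n-1$): $${\not\!\!D}^{res}_{2N}(h;\lambda)=2^{2N}N!\Big[\prod_{k=0}^{N-1}(\lambda+\tfrac n2-2N+k)\Big]{\not\!\delta}_{2N}(h;\lambda+\tfrac{n-1}{2}-2N),$$ $${\not\!\!D}^{res}_{2N+1}(h;\lambda)=2^{2N+1}N!\Big[\prod_{k=0}^{N}(\lambda+\tfrac n2-2N-1+k)\Big]{\not\!\delta}_{2N+1}(h;\lambda+\tfrac{n-1}{2}-2N-1).$$ The prefactors cancel all poles, so these are polynomial in $\lambda$ (values at poles of ${\not\!\delta}$ are understood by polynomial continuation). They map spinors on $\mathbb{R}^n_{x_n\ge0}$ to $\Delta_n$-valued functions on $\mathbb{R}^{n-1}$. Gegenbauer coefficients: for $N\in\mathbb{N}_0$, $a_N^{(N)}(\lambda)=b_N^{(N)}(\lambda)=(-1)^N$ and for $0\le j\le N-1$ $$a_j^{(N)}(\lambda)=\frac{N!(-2)^{N-j}}{j!(2N-2j)!}\prod_{k=j}^{N-1}(2\lambda-4N+2k+n+1)\,a_N^{(N)}(\lambda),$$ $$b_j^{(N)}(\lambda)=\frac{N!(-2)^{N-j}}{j!(2N-2j+1)!}\prod_{k=j}^{N-1}(2\lambda-4N+2k+n-1)\,b_N^{(N)}(\lambda).$$ Empty sums are $0$ and empty products are $1$. *)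

theory Defs
  imports "HOL-Analysis.Analysis"
begin

(* Conventions.  R^n is real^('m option) with 'm an arbitrary finite index type, so that
   n = CARD('m option) = CARD('m) + 1 >= 2 is arbitrary.  The index None is the normal
   direction n, the indices Some i are the n - 1 tangential directions, and the boundary
   R^(n-1) is real^'m, with its euclidean metric.  The spinor module is complex^'d, on which
   e i acts by a complex matrix.  The spectral parameter is written \<nu>. *)

definition complex_spinor_module :: "('k::finite \<Rightarrow> complex^'d^'d) \<Rightarrow> bool" where
  "complex_spinor_module e \<longleftrightarrow>
     (\<forall>i j. e i ** e j + e j ** e i = mat (if i = j then - 2 else 0)) \<and>
     (\<forall>V. vec.subspace V \<and> (\<forall>i. \<forall>v\<in>V. e i *v v \<in> V) \<longrightarrow> V = {0} \<or> V = UNIV)"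

(* By irreducibility CARD('d) = 2 ^ (CARD('k) div 2), and e is unique up to isomorphism if
   CARD('k) is even; if it is odd there are two such modules, and both are admitted. *)


section \<open>Smooth functions on the half-space and on its boundary\<close>

(* The i-th partial derivative, taken within S; at a boundary point of the half-space the
   normal derivative is one-sided. *)
definition partial_on ::
  "(real^'k) set \<Rightarrow> 'k \<Rightarrow> (real^'k \<Rightarrow> 'a::real_normed_vector) \<Rightarrow> real^'k \<Rightarrow> 'a" where
  "partial_on S i f x =
     vector_derivative (\<lambda>t. f (x + t *\<^sub>R axis i 1)) (at 0 within {t. x + t *\<^sub>R axis i 1 \<in> S})"

primrec Ck_on ::
  "nat \<Rightarrow> (real^'k) set \<Rightarrow> (real^'k \<Rightarrow> 'a::real_normed_vector) \<Rightarrow> bool" where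
  "Ck_on 0 S f \<longleftrightarrow> continuous_on S f"
| "Ck_on (Suc r) S f \<longleftrightarrow> continuous_on S f \<and>
     (\<forall>i. (\<forall>x\<in>S. (\<lambda>t. f (x + t *\<^sub>R axis i 1)) differentiable
                    (at 0 within {t. x + t *\<^sub>R axis i 1 \<in> S})) \<and>
          Ck_on r S (partial_on S i f))"

(* Meant for S = UNIV and for S a closed half-space, where it says that all iterated partial
   derivatives exist and are continuous up to the boundary. *)
definition smooth_on ::
  "(real^'k) set \<Rightarrow> (real^'k \<Rightarrow> 'a::real_normed_vector) \<Rightarrow> bool" where
  "smooth_on S f \<longleftrightarrow> (\<forall>r. Ck_on r S f)"

definition half_space :: "(real^('m::finite option)) set" where
  "half_space = {x. x $ None \<ge> 0}"

definition bdry_embed :: "real^'m \<Rightarrow> real^('m::finite option)" where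
  "bdry_embed y = (\<chi> i. case i of None \<Rightarrow> 0 | Some j \<Rightarrow> y $ j)"

definition restrict_bdry :: "(real^('m::finite option) \<Rightarrow> 'a) \<Rightarrow> real^'m \<Rightarrow> 'a" where
  "restrict_bdry \<psi> y = \<psi> (bdry_embed y)"


section \<open>Dirac operators\<close>

abbreviation normal_deriv ::
  "(real^('m::finite option) \<Rightarrow> complex^'d) \<Rightarrow> real^('m option) \<Rightarrow> complex^'d" where
  "normal_deriv \<equiv> partial_on half_space None"

definition D_N :: "('m::finite option \<Rightarrow> complex^'d^'d) \<Rightarrow>
    (real^('m option) \<Rightarrow> complex^'d) \<Rightarrow> real^('m option) \<Rightarrow> complex^'d" where
  "D_N e \<psi> x = e None *v normal_deriv \<psi> x"

definition D_T :: "('m::finite option \<Rightarrow> complex^'d^'d) \<Rightarrow>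
    (real^'m \<Rightarrow> complex^'d) \<Rightarrow> real^'m \<Rightarrow> complex^'d" where
  "D_T e \<phi> y = (\<Sum>i\<in>UNIV. e (Some i) *v partial_on UNIV i \<phi> y)"

definition D_tilde :: "('m::finite option \<Rightarrow> complex^'d^'d) \<Rightarrow>
    (real^'m \<Rightarrow> complex^'d) \<Rightarrow> real^'m \<Rightarrow> complex^'d" where
  "D_tilde e \<phi> y = e None *v (\<Sum>i\<in>UNIV. e (Some i) *v partial_on UNIV i \<phi> y)"


section \<open>Solution operators and residue families\<close>

definition sol_coeff :: "nat \<Rightarrow> complex \<Rightarrow> complex" where
  "sol_coeff j \<nu> = (let l = j div 2 in
     if even j then 1 / (2 ^ (2 * l) * fact l * pochhammer (1/2 + \<nu>) l)
     else 1 / (2 ^ (2 * l + 1) * fact l * pochhammer (1/2 + \<nu>) (l + 1)))"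

definition sol_op :: "('m::finite option \<Rightarrow> complex^'d^'d) \<Rightarrow> nat \<Rightarrow> complex \<Rightarrow>
    (real^'m \<Rightarrow> complex^'d) \<Rightarrow> real^'m \<Rightarrow> complex^'d" where
  "sol_op e j \<nu> \<phi> y = sol_coeff j \<nu> *s (D_tilde e ^^ j) \<phi> y"

definition delta_op :: "('m::finite option \<Rightarrow> complex^'d^'d) \<Rightarrow> nat \<Rightarrow> complex \<Rightarrow>
    (real^('m option) \<Rightarrow> complex^'d) \<Rightarrow> real^'m \<Rightarrow> complex^'d" where
  "delta_op e N \<nu> \<psi> y =
     (\<Sum>j\<le>N. (1 / fact (N - j)) *s
        sol_op e j \<nu> (restrict_bdry ((normal_deriv ^^ (N - j)) \<psi>)) y)"

definition res_prefactor :: "nat \<Rightarrow> nat \<Rightarrow> complex \<Rightarrow> complex" where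
  "res_prefactor n M \<nu> = (let N = M div 2 in
     if even M
     then 2 ^ (2 * N) * fact N *
          (\<Prod>k<N. \<nu> + of_nat n / 2 - 2 * of_nat N + of_nat k)
     else 2 ^ (2 * N + 1) * fact N *
          (\<Prod>k\<le>N. \<nu> + of_nat n / 2 - 2 * of_nat N - 1 + of_nat k))"

(* The product of the prefactor and delta_op is polynomial in the parameter away from the
   finitely many poles of delta_op, where division by zero makes sol_coeff meaningless.  The
   limit over the punctured neighbourhood is its polynomial continuation, at every \<nu>. *)
definition D_res :: "('m::finite option \<Rightarrow> complex^'d^'d) \<Rightarrow> nat \<Rightarrow> complex \<Rightarrow>
    (real^('m option) \<Rightarrow> complex^'d) \<Rightarrow> real^'m \<Rightarrow> complex^'d" where
  "D_res e M \<nu> \<psi> y =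
     (let n = CARD('m option) in
      Lim (at \<nu>) (\<lambda>\<mu>. res_prefactor n M \<mu> *s
                      delta_op e M (\<mu> + (of_nat n - 1) / 2 - of_nat M) \<psi> y))"


section \<open>Gegenbauer coefficients\<close>

(* Only the values at j <= N are meaningful. *)
definition geg_a :: "nat \<Rightarrow> nat \<Rightarrow> nat \<Rightarrow> complex \<Rightarrow> complex" where
  "geg_a n N j \<nu> = (if j = N then (- 1) ^ N else
     fact N * (- 2) ^ (N - j) / (fact j * fact (2 * N - 2 * j)) *
     (\<Prod>k=j..<N. 2 * \<nu> - 4 * of_nat N + 2 * of_nat k + of_nat n + 1) * (- 1) ^ N)"

definition geg_b :: "nat \<Rightarrow> nat \<Rightarrow> nat \<Rightarrow> complex \<Rightarrow> complex" where
  "geg_b n N j \<nu> = (if j = N then (- 1) ^ N else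
     fact N * (- 2) ^ (N - j) / (fact j * fact (2 * N - 2 * j + 1)) *
     (\<Prod>k=j..<N. 2 * \<nu> - 4 * of_nat N + 2 * of_nat k + of_nat n - 1) * (- 1) ^ N)"

definition c_coeff :: "nat \<Rightarrow> nat \<Rightarrow> complex \<Rightarrow> complex" where
  "c_coeff n N \<nu> = 2 * \<nu> + of_nat n - 2 * of_nat N - 2"

end

theory Submission
  imports Defs
begin

text \<open>
  Since \<open>e\<^sub>n\<close> anticommutes with the tangential Clifford multiplications and squares to \<open>-1\<close>,
  even powers of the operator \<open>D_tilde\<close> equal those of \<open>D_T\<close>, odd powers differ by a factor \<open>e\<^sub>n\<close>, and
  normal derivatives are powers of \<open>D_N\<close> up to sign and a factor \<open>e\<^sub>n\<close>. Away from the poles the theorem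
  thus reduces to comparing scalar coefficients, where the prefactor of the residue family
  cancels all but a tail of the Pochhammer symbol, which is the product in the Gegenbauer
  coefficient. The right-hand side is continuous in the spectral parameter, so it is also the
  value of the limit at the poles.
\<close>

section \<open>Partial derivatives and smoothness\<close>

text \<open>The filter only sees slice parameters \<open>t\<close> whose point lies in
  \<open>S\<close>, and \<open>x \<in> S\<close> covers the value at \<open>t = 0\<close>, so the
  values of the functions off \<open>S\<close> never matter.\<close>

lemma partial_on_cong:
  assumes "\<And>x. x \<in> S \<Longrightarrow> f x = g x" and "x \<in> S"
  shows "partial_on S i f x = partial_on S i g x"
proof -
  have "((\<lambda>t. f (x + t *\<^sub>R axis i 1)) has_vector_derivative D) (at 0 within {t. x + t *\<^sub>R axis i 1 \<in> S})
    \<longleftrightarrow> ((\<lambda>t. g (x + t *\<^sub>R axis i 1)) has_vector_derivative D) (at 0 within {t. x + t *\<^sub>R axis i 1 \<in> S})" for D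
    by (rule has_vector_derivative_cong_ev) (use assms in auto)
  then show ?thesis
    by (simp add: partial_on_def vector_derivative_def)
qed

lemma differentiable_slice_cong:
  assumes "\<And>x. x \<in> S \<Longrightarrow> f x = g x" and "x \<in> S"
  shows "(\<lambda>t. f (x + t *\<^sub>R axis i 1)) differentiable (at 0 within {t. x + t *\<^sub>R axis i 1 \<in> S}) \<longleftrightarrow>
         (\<lambda>t. g (x + t *\<^sub>R axis i 1)) differentiable (at 0 within {t. x + t *\<^sub>R axis i 1 \<in> S})"
proof -
  \<comment> \<open>The functions agree along the entire slice, so the radius 1 is an arbitrary
    choice.\<close>
  have "((\<lambda>t. f (x + t *\<^sub>R axis i 1)) has_derivative D) (at 0 within {t. x + t *\<^sub>R axis i 1 \<in> S})
    \<longleftrightarrow> ((\<lambda>t. g (x + t *\<^sub>R axis i 1)) has_derivative D) (at 0 within {t. x + t *\<^sub>R axis i 1 \<in> S})" for D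
    by (intro iffI; erule has_derivative_transform_within[OF _ zero_less_one])
      (use assms in auto)
  then show ?thesis
    by (simp add: differentiable_def)
qed

lemma Ck_on_cong:
  assumes "\<And>x. x \<in> S \<Longrightarrow> f x = g x"
  shows "Ck_on r S f \<longleftrightarrow> Ck_on r S g"
  using assms
proof (induction r arbitrary: f g)
  case 0
  then show ?case by (simp cong: continuous_on_cong)
next
  case (Suc r)
  have "Ck_on r S (partial_on S i f) \<longleftrightarrow> Ck_on r S (partial_on S i g)" for i
    by (rule Suc.IH) (rule partial_on_cong[OF Suc.prems])
  moreover have "continuous_on S f \<longleftrightarrow> continuous_on S g"
    using Suc.prems by (simp cong: continuous_on_cong)
  ultimately show ?case
    using differentiable_slice_cong[of S f g, OF Suc.prems] by simp
qed

lemma smooth_on_partial: "smooth_on S f \<Longrightarrow> smooth_on S (partial_on S i f)"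
  unfolding smooth_on_def by (metis Ck_on.simps(2))

lemma smooth_on_differentiable:
  assumes "smooth_on S f" and "x \<in> S"
  shows "(\<lambda>t. f (x + t *\<^sub>R axis i 1)) differentiable (at 0 within {t. x + t *\<^sub>R axis i 1 \<in> S})"
proof -
  have "Ck_on (Suc 0) S f"
    using assms(1) unfolding smooth_on_def by blast
  then show ?thesis
    using assms(2) by simp
qed

text \<open>On such sets the one-sided partial derivatives are uniquely determined.\<close>

definition slice_regular :: "(real^'k) set \<Rightarrow> bool" where
  "slice_regular S \<longleftrightarrow> (\<forall>x\<in>S. \<forall>i. at 0 within {t. x + t *\<^sub>R axis i 1 \<in> S} \<noteq> bot)"

lemma slice_regular_UNIV: "slice_regular UNIV"
  by (simp add: slice_regular_def)

text \<open>Moving in the positive direction along any axis never leaves the half-space, even from a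
  boundary point. Every slice thus contains \<open>{0..}\<close>, which accumulates at 0.\<close>

lemma slice_regular_half_space: "slice_regular half_space"
  unfolding slice_regular_def
proof (intro ballI allI)
  fix x :: "real^('a option)" and i
  assume "x \<in> half_space"
  then have "{0..} \<subseteq> {t. x + t *\<^sub>R axis i 1 \<in> half_space}"
    by (auto simp: half_space_def axis_def)
  moreover have "at 0 within {0::real..} \<noteq> bot"
    by (metis at_within_Ici_at_right trivial_limit_at_right_real)
  ultimately show "at 0 within {t. x + t *\<^sub>R axis i 1 \<in> half_space} \<noteq> bot"
    by (metis at_le bot.extremum_uniqueI)
qed

text \<open>The chain rule exhibits a derivative; slice regularity makes it unique, so it is the one
  chosen by \<open>vector_derivative\<close>. Real linearity of \<open>L\<close> suffices, which
  serves complex scaling and Clifford multiplication alike.\<close>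

lemma partial_on_linear:
  assumes "bounded_linear L" and "slice_regular S" and "x \<in> S"
    and "(\<lambda>t. f (x + t *\<^sub>R axis i 1)) differentiable (at 0 within {t. x + t *\<^sub>R axis i 1 \<in> S})"
  shows "partial_on S i (\<lambda>x. L (f x)) x = L (partial_on S i f x)"
  unfolding partial_on_def
proof (rule vector_derivative_within)
  show "at 0 within {t. x + t *\<^sub>R axis i 1 \<in> S} \<noteq> bot"
    using assms by (simp add: slice_regular_def)
  show "((\<lambda>t. L (f (x + t *\<^sub>R axis i 1))) has_vector_derivative
      L (vector_derivative (\<lambda>t. f (x + t *\<^sub>R axis i 1)) (at 0 within {t. x + t *\<^sub>R axis i 1 \<in> S})))
      (at 0 within {t. x + t *\<^sub>R axis i 1 \<in> S})"
    by (rule bounded_linear.has_vector_derivative[OF assms(1)])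
      (use assms(4) vector_derivative_works in blast)
qed

lemma partial_on_add:
  assumes "slice_regular S" and "x \<in> S"
    and "(\<lambda>t. f (x + t *\<^sub>R axis i 1)) differentiable (at 0 within {t. x + t *\<^sub>R axis i 1 \<in> S})"
    and "(\<lambda>t. g (x + t *\<^sub>R axis i 1)) differentiable (at 0 within {t. x + t *\<^sub>R axis i 1 \<in> S})"
  shows "partial_on S i (\<lambda>x. f x + g x) x = partial_on S i f x + partial_on S i g x"
  unfolding partial_on_def
  by (rule vector_derivative_within)
    (use assms in \<open>auto simp: slice_regular_def vector_derivative_works[symmetric]
       intro: has_vector_derivative_add\<close>)

text \<open>The induction keeps \<open>f\<close> arbitrary because its hypothesis is applied to the
  partial derivatives. These are known to commute with \<open>L\<close> at points of
  \<open>S\<close> only, hence the passage through \<open>Ck_on_cong\<close>.\<close>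

lemma Ck_on_linear:
  assumes "bounded_linear L" and "slice_regular S" and "Ck_on r S f"
  shows "Ck_on r S (\<lambda>x. L (f x))"
  using assms(3)
proof (induction r arbitrary: f)
  case 0
  then show ?case
    by (simp add: bounded_linear.continuous_on[OF assms(1)])
next
  case (Suc r)
  have "Ck_on r S (partial_on S i (\<lambda>x. L (f x)))" for i
  proof -
    have "Ck_on r S (\<lambda>x. L (partial_on S i f x))"
      using Suc by simp
    then show ?thesis
      using Suc.prems partial_on_linear[OF assms(1,2)]
      by (subst Ck_on_cong[where g = "\<lambda>x. L (partial_on S i f x)"]) auto
  qed
  moreover have "(\<lambda>t. L (f (x + t *\<^sub>R axis i 1))) differentiable
      (at 0 within {t. x + t *\<^sub>R axis i 1 \<in> S})" if "x \<in> S" for x i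
    using Suc.prems that bounded_linear.has_derivative[OF assms(1)]
    by (simp add: differentiable_def) blast
  moreover have "continuous_on S (\<lambda>x. L (f x))"
    using Suc.prems by (simp add: bounded_linear.continuous_on[OF assms(1)])
  ultimately show ?case by simp
qed

lemma Ck_on_add:
  assumes "slice_regular S" and "Ck_on r S f" and "Ck_on r S g"
  shows "Ck_on r S (\<lambda>x. f x + g x)"
  using assms(2,3)
proof (induction r arbitrary: f g)
  case 0
  then show ?case by (simp add: continuous_on_add)
next
  case (Suc r)
  have "Ck_on r S (partial_on S i (\<lambda>x. f x + g x))" for i
  proof -
    have "Ck_on r S (\<lambda>x. partial_on S i f x + partial_on S i g x)"
      using Suc by simp
    then show ?thesis
      using Suc.prems partial_on_add[OF assms(1), of _ f i g]
      by (subst Ck_on_cong[where g = "\<lambda>x. partial_on S i f x + partial_on S i g x"]) simp_all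
  qed
  then show ?case
    using Suc.prems by (simp add: continuous_on_add)
qed

lemma smooth_on_linear:
  "bounded_linear L \<Longrightarrow> slice_regular S \<Longrightarrow> smooth_on S f \<Longrightarrow> smooth_on S (\<lambda>x. L (f x))"
  unfolding smooth_on_def using Ck_on_linear by blast

lemma smooth_on_sum:
  assumes "slice_regular S" and "finite I" and "I \<noteq> {}" and "\<And>i. i \<in> I \<Longrightarrow> smooth_on S (f i)"
  shows "smooth_on S (\<lambda>x. \<Sum>i\<in>I. f i x)"
  using assms(2-4)
  by (induction I rule: finite_ne_induct) (auto simp: smooth_on_def intro: Ck_on_add[OF assms(1)])

lemma smooth_on_funpow_partial: "smooth_on S f \<Longrightarrow> smooth_on S ((partial_on S i ^^ k) f)"
  by (induction k) (simp_all add: smooth_on_partial)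

section \<open>Restriction to the boundary hyperplane\<close>

lemma bdry_embed_half_space: "bdry_embed y \<in> half_space"
  by (simp add: bdry_embed_def half_space_def)

lemma bdry_embed_slice:
  "bdry_embed (y + t *\<^sub>R axis i 1) = bdry_embed y + t *\<^sub>R axis (Some i) 1"
  by (auto simp: vec_eq_iff bdry_embed_def axis_def split: option.split)

text \<open>Tangential lines through boundary points stay in the boundary, so the filter for
  tangential derivatives there is the full two-sided one.\<close>

lemma bdry_slice_UNIV: "{t. bdry_embed y + t *\<^sub>R axis (Some i) 1 \<in> half_space} = UNIV"
  by (metis (mono_tags, lifting) UNIV_eq_I bdry_embed_half_space bdry_embed_slice mem_Collect_eq)

lemma partial_on_restrict_bdry:
  "partial_on UNIV i (restrict_bdry f) = restrict_bdry (partial_on half_space (Some i) f)"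
  by (rule ext) (simp add: partial_on_def restrict_bdry_def bdry_embed_slice bdry_slice_UNIV)

lemma continuous_on_bdry_embed: "continuous_on UNIV bdry_embed"
  unfolding bdry_embed_def
proof (rule continuous_on_vec_lambda)
  fix i :: "'a option"
  show "continuous_on UNIV (\<lambda>y. case i of None \<Rightarrow> 0 | Some j \<Rightarrow> y $ j)"
    by (cases i) (auto intro!: continuous_intros)
qed

lemma continuous_on_restrict_bdry:
  "continuous_on half_space f \<Longrightarrow> continuous_on UNIV (restrict_bdry f)"
  unfolding restrict_bdry_def[abs_def]
  by (rule continuous_on_compose2[OF _ continuous_on_bdry_embed]) (auto simp: bdry_embed_half_space)

text \<open>Only tangential derivatives of the restriction occur, and these are restrictions of
  tangential derivatives, to which the induction hypothesis applies.\<close>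

lemma Ck_on_restrict_bdry: "Ck_on r half_space f \<Longrightarrow> Ck_on r UNIV (restrict_bdry f)"
proof (induction r arbitrary: f)
  case 0
  then show ?case
    by (simp add: continuous_on_restrict_bdry)
next
  case (Suc r)
  have "continuous_on UNIV (restrict_bdry f)"
    using Suc.prems by (simp add: continuous_on_restrict_bdry)
  moreover have "(\<lambda>t. restrict_bdry f (y + t *\<^sub>R axis i 1)) differentiable at 0" for y i
    using Suc.prems bdry_embed_half_space[of y] bdry_slice_UNIV[of y i]
    by (simp add: restrict_bdry_def bdry_embed_slice) metis
  ultimately show ?case
    using Suc by (simp add: partial_on_restrict_bdry)
qed

lemma smooth_on_restrict_bdry: "smooth_on half_space f \<Longrightarrow> smooth_on UNIV (restrict_bdry f)"
  by (simp add: smooth_on_def Ck_on_restrict_bdry)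

section \<open>Clifford algebra\<close>

lemma mat_mult_vec: "mat c *v v = c *s (v :: complex^'d)"
  by (simp add: vec_eq_iff mat_def matrix_vector_mult_def mult_delta_left)

text \<open>Complex scaling is multiplication by a scalar matrix, and matrix multiplication is
  bounded linear.\<close>

lemma bounded_linear_smult: "bounded_linear ((*s) c :: complex^'d \<Rightarrow> complex^'d)"
proof -
  have "((*s) c :: complex^'d \<Rightarrow> complex^'d) = (*v) (mat c)"
    by (rule ext) (rule mat_mult_vec[symmetric])
  then show ?thesis
    by simp
qed

lemma clifford_relation:
  assumes "complex_spinor_module e"
  shows "e i *v (e j *v v) + e j *v (e i *v v) = (if i = j then - 2 else 0) *s v"
proof -
  have "e i ** e j + e j ** e i = mat (if i = j then - 2 else 0)"
    using assms unfolding complex_spinor_module_def by blast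
  then show ?thesis
    unfolding matrix_vector_mul_assoc by (metis mat_mult_vec matrix_vector_mult_add_rdistrib)
qed

lemma clifford_square:
  assumes "complex_spinor_module e"
  shows "e i *v (e i *v v) = - v"
proof -
  have "e i *v (e i *v v) + e i *v (e i *v v) = - 2 *s v"
    using clifford_relation[OF assms, of i i v] by simp
  then have "2 * (e i *v (e i *v v)) $ k = 2 * (- v) $ k" for k
    by (simp add: vec_eq_iff)
  then show ?thesis
    by (simp add: vec_eq_iff)
qed

lemma clifford_anticomm:
  assumes "complex_spinor_module e" and "i \<noteq> j"
  shows "e i *v (e j *v v) = - (e j *v (e i *v v))"
  using clifford_relation[OF assms(1), of i j v] assms(2) by (simp add: eq_neg_iff_add_eq_0)

section \<open>Algebra of the Dirac operators\<close>

lemma smooth_on_D_T: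
  assumes "smooth_on UNIV \<phi>"
  shows "smooth_on UNIV (D_T e \<phi>)"
proof -
  have "smooth_on UNIV (\<lambda>y. e (Some i) *v partial_on UNIV i \<phi> y)" for i
    by (rule smooth_on_linear[OF matrix_vector_mul_bounded_linear slice_regular_UNIV])
      (rule smooth_on_partial[OF assms])
  then show ?thesis
    unfolding D_T_def[abs_def] by (intro smooth_on_sum slice_regular_UNIV) auto
qed

lemma smooth_on_funpow_D_T: "smooth_on UNIV \<phi> \<Longrightarrow> smooth_on UNIV ((D_T e ^^ k) \<phi>)"
  by (induction k) (simp_all add: smooth_on_D_T)

lemma D_T_smult:
  assumes "smooth_on UNIV \<phi>"
  shows "D_T e (\<lambda>y. c *s \<phi> y) = (\<lambda>y. c *s D_T e \<phi> y)"
proof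
  fix y
  have "partial_on UNIV i (\<lambda>y. c *s \<phi> y) y = c *s partial_on UNIV i \<phi> y" for i
    by (rule partial_on_linear[OF bounded_linear_smult slice_regular_UNIV UNIV_I
          smooth_on_differentiable[OF assms UNIV_I]])
  then show "D_T e (\<lambda>y. c *s \<phi> y) y = c *s D_T e \<phi> y"
    by (simp add: D_T_def vector_scalar_commute vec.scale_sum_right)
qed

text \<open>The constant matrix \<open>e None\<close> commutes with the partial derivatives and
  anticommutes with every \<open>e (Some i)\<close>. The sign is kept as a scalar factor so that
  \<open>D_T_smult\<close> can move it when the operator is iterated.\<close>

lemma D_T_clifford_normal:
  assumes "complex_spinor_module e" and "smooth_on UNIV \<phi>"
  shows "D_T e (\<lambda>y. e None *v \<phi> y) = (\<lambda>y. - 1 *s (e None *v D_T e \<phi> y))"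
proof
  fix y
  have "partial_on UNIV i (\<lambda>y. e None *v \<phi> y) y = e None *v partial_on UNIV i \<phi> y" for i
    by (rule partial_on_linear[OF matrix_vector_mul_bounded_linear slice_regular_UNIV UNIV_I
          smooth_on_differentiable[OF assms(2) UNIV_I]])
  moreover have "e (Some i) *v (e None *v v) = - (e None *v (e (Some i) *v v))" for i v
    by (rule clifford_anticomm[OF assms(1)]) simp
  ultimately show "D_T e (\<lambda>y. e None *v \<phi> y) y = - 1 *s (e None *v D_T e \<phi> y)"
    by (simp add: D_T_def linear_sum[OF matrix_vector_mul_linear] sum_negf flip: vector_sneg_minus1)
qed

lemma funpow_D_T_smult:
  assumes "smooth_on UNIV \<phi>"
  shows "(D_T e ^^ k) (\<lambda>y. c *s \<phi> y) = (\<lambda>y. c *s (D_T e ^^ k) \<phi> y)"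
  by (induction k) (simp_all add: D_T_smult smooth_on_funpow_D_T assms)

lemma funpow_D_T_clifford_normal:
  assumes "complex_spinor_module e" and "smooth_on UNIV \<phi>"
  shows "(D_T e ^^ k) (\<lambda>y. e None *v \<phi> y) = (\<lambda>y. (- 1) ^ k *s (e None *v (D_T e ^^ k) \<phi> y))"
proof (induction k)
  case (Suc k)
  have "smooth_on UNIV (\<lambda>y. e None *v (D_T e ^^ k) \<phi> y)"
    by (intro smooth_on_linear[OF matrix_vector_mul_bounded_linear slice_regular_UNIV]
        smooth_on_funpow_D_T assms)
  then show ?case
    using Suc by (simp add: D_T_smult D_T_clifford_normal[OF assms(1)] smooth_on_funpow_D_T assms
        vector_smult_assoc)
qed simp

lemma D_tilde_eq: "D_tilde e \<phi> = (\<lambda>y. e None *v D_T e \<phi> y)"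
  by (rule ext) (simp add: D_tilde_def D_T_def)

text \<open>Moving e_n past the inner operator gives (e_n D_T)(e_n D_T) = - e_n e_n D_T^2 =
  D_T^2.\<close>

lemma funpow_D_tilde_even:
  assumes "complex_spinor_module e" and "smooth_on UNIV \<phi>"
  shows "(D_tilde e ^^ (2 * l)) \<phi> = (D_T e ^^ (2 * l)) \<phi>"
proof (induction l)
  case (Suc l)
  have "D_tilde e (D_tilde e \<omega>) = D_T e (D_T e \<omega>)" if "smooth_on UNIV \<omega>" for \<omega>
    using that by (simp add: D_tilde_eq D_T_clifford_normal[OF assms(1)] smooth_on_D_T
        linear_neg[OF matrix_vector_mul_linear] clifford_square[OF assms(1)]
        flip: vector_sneg_minus1)
  then show ?case
    using Suc by (simp add: smooth_on_funpow_D_T assms)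
qed simp

lemma funpow_D_tilde_odd:
  assumes "complex_spinor_module e" and "smooth_on UNIV \<phi>"
  shows "(D_tilde e ^^ (2 * l + 1)) \<phi> = (\<lambda>y. e None *v (D_T e ^^ (2 * l + 1)) \<phi> y)"
  using funpow_D_tilde_even[OF assms] by (simp add: D_tilde_eq)

section \<open>Powers of the normal Dirac operator on the half-space\<close>

lemma D_N_cong:
  "(\<And>x. x \<in> half_space \<Longrightarrow> f x = g x) \<Longrightarrow> x \<in> half_space \<Longrightarrow> D_N e f x = D_N e g x"
  unfolding D_N_def by (metis partial_on_cong)

lemma D_N_D_N:
  assumes "complex_spinor_module e" and "smooth_on half_space \<psi>" and "x \<in> half_space"
  shows "D_N e (D_N e \<psi>) x = - normal_deriv (normal_deriv \<psi>) x"
proof -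
  have "normal_deriv (\<lambda>x. e None *v normal_deriv \<psi> x) x = e None *v normal_deriv (normal_deriv \<psi>) x"
    by (rule partial_on_linear[OF matrix_vector_mul_bounded_linear slice_regular_half_space assms(3)
          smooth_on_differentiable[OF smooth_on_partial[OF assms(2)] assms(3)]])
  then show ?thesis
    by (simp add: D_N_def[abs_def] clifford_square[OF assms(1)])
qed

lemma smooth_on_D_N: "smooth_on half_space \<psi> \<Longrightarrow> smooth_on half_space (D_N e \<psi>)"
  unfolding D_N_def[abs_def]
  by (intro smooth_on_linear[OF matrix_vector_mul_bounded_linear slice_regular_half_space]
      smooth_on_partial)

lemma D_N_smult:
  assumes "smooth_on half_space \<psi>" and "x \<in> half_space"
  shows "D_N e (\<lambda>x. c *s \<psi> x) x = c *s D_N e \<psi> x"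
proof -
  have "normal_deriv (\<lambda>x. c *s \<psi> x) x = c *s normal_deriv \<psi> x"
    by (rule partial_on_linear[OF bounded_linear_smult slice_regular_half_space assms(2)
          smooth_on_differentiable[OF assms]])
  then show ?thesis
    by (simp add: D_N_def vector_scalar_commute)
qed

lemma funpow_D_N_even:
  assumes "complex_spinor_module e" and "smooth_on half_space \<psi>" and "x \<in> half_space"
  shows "(D_N e ^^ (2 * k)) \<psi> x = (- 1) ^ k *s (normal_deriv ^^ (2 * k)) \<psi> x"
  using assms(3)
proof (induction k arbitrary: x)
  case (Suc k)
  let ?\<omega> = "(normal_deriv ^^ (2 * k)) \<psi>"
  have sm: "smooth_on half_space ?\<omega>"
    by (rule smooth_on_funpow_partial[OF assms(2)])
  \<comment> \<open>Needed at every \<open>z\<close> of the half-space, not only at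
    \<open>x\<close>, because a further \<open>D_N\<close> differentiates it. The induction
    hypothesis says nothing off the half-space, so \<open>D_N_cong\<close> takes the place of
    rewriting by an equality of functions.\<close>
  have step: "D_N e ((D_N e ^^ (2 * k)) \<psi>) z = (- 1) ^ k *s D_N e ?\<omega> z"
    if "z \<in> half_space" for z
  proof -
    have "D_N e ((D_N e ^^ (2 * k)) \<psi>) z = D_N e (\<lambda>x. (- 1) ^ k *s ?\<omega> x) z"
      by (rule D_N_cong) (use Suc.IH that in auto)
    then show ?thesis
      using D_N_smult[OF sm that, of e "(- 1) ^ k"] by (rule trans)
  qed
  have "D_N e (D_N e ((D_N e ^^ (2 * k)) \<psi>)) x = D_N e (\<lambda>x. (- 1) ^ k *s D_N e ?\<omega> x) x"
    by (rule D_N_cong) (use step Suc.prems in auto)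
  also have "\<dots> = (- 1) ^ k *s D_N e (D_N e ?\<omega>) x"
    by (rule D_N_smult[OF smooth_on_D_N[OF sm] Suc.prems])
  also have "\<dots> = (- 1) ^ Suc k *s normal_deriv (normal_deriv ?\<omega>) x"
    by (simp add: D_N_D_N[OF assms(1) sm Suc.prems] vec_eq_iff)
  finally show ?case by simp
qed simp

lemma funpow_D_N_odd:
  assumes "complex_spinor_module e" and "smooth_on half_space \<psi>" and "x \<in> half_space"
  shows "(D_N e ^^ (2 * k + 1)) \<psi> x = (- 1) ^ k *s (e None *v (normal_deriv ^^ (2 * k + 1)) \<psi> x)"
proof -
  have "D_N e ((D_N e ^^ (2 * k)) \<psi>) x = D_N e (\<lambda>x. (- 1) ^ k *s (normal_deriv ^^ (2 * k)) \<psi> x) x"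
    by (rule D_N_cong) (use funpow_D_N_even[OF assms(1,2)] assms(3) in auto)
  also have "\<dots> = (- 1) ^ k *s D_N e ((normal_deriv ^^ (2 * k)) \<psi>) x"
    by (rule D_N_smult[OF smooth_on_funpow_partial[OF assms(2)] assms(3)])
  finally show ?thesis
    by (simp add: D_N_def)
qed

section \<open>Tangential powers applied to restricted normal powers\<close>

lemma funpow_D_T_restrict_even:
  assumes "complex_spinor_module e" and "smooth_on half_space \<psi>"
  shows "(D_T e ^^ j) (restrict_bdry ((D_N e ^^ (2 * k)) \<psi>)) y =
    (- 1) ^ k *s (D_T e ^^ j) (restrict_bdry ((normal_deriv ^^ (2 * k)) \<psi>)) y"
proof -
  have "restrict_bdry ((D_N e ^^ (2 * k)) \<psi>) =
      (\<lambda>y. (- 1) ^ k *s restrict_bdry ((normal_deriv ^^ (2 * k)) \<psi>) y)"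
    using funpow_D_N_even[OF assms] by (auto simp: restrict_bdry_def bdry_embed_half_space)
  then show ?thesis
    by (simp add: funpow_D_T_smult smooth_on_restrict_bdry smooth_on_funpow_partial assms)
qed

text \<open>In the exponent, \<open>k\<close> comes from the squares of \<open>D_N\<close>, and
  \<open>j\<close> from moving the one leftover \<open>e None\<close> to the left of
  \<open>j\<close> tangential operators.\<close>

lemma funpow_D_T_restrict_odd:
  assumes "complex_spinor_module e" and "smooth_on half_space \<psi>"
  shows "(D_T e ^^ j) (restrict_bdry ((D_N e ^^ (2 * k + 1)) \<psi>)) y =
    (- 1) ^ (k + j) *s (e None *v (D_T e ^^ j) (restrict_bdry ((normal_deriv ^^ (2 * k + 1)) \<psi>)) y)"
proof -
  let ?\<phi> = "restrict_bdry ((normal_deriv ^^ (2 * k + 1)) \<psi>)"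
  have sm: "smooth_on UNIV ?\<phi>"
    by (intro smooth_on_restrict_bdry smooth_on_funpow_partial assms)
  have sm': "smooth_on UNIV (\<lambda>y. e None *v ?\<phi> y)"
    by (rule smooth_on_linear[OF matrix_vector_mul_bounded_linear slice_regular_UNIV sm])
  have "restrict_bdry ((D_N e ^^ (2 * k + 1)) \<psi>) = (\<lambda>y. (- 1) ^ k *s (e None *v ?\<phi> y))"
    using funpow_D_N_odd[OF assms] by (auto simp: restrict_bdry_def bdry_embed_half_space)
  then show ?thesis
    by (simp only: funpow_D_T_smult[OF sm'] funpow_D_T_clifford_normal[OF assms(1) sm]
        vector_smult_assoc power_add)
qed

section \<open>Coefficients\<close>

lemma pochhammer_ratio:
  fixes x :: complex
  assumes "l \<le> N" and "pochhammer x l \<noteq> 0"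
  shows "pochhammer x N / pochhammer x l = (\<Prod>k=l..<N. x + of_nat k)"
proof -
  have "pochhammer x N = pochhammer x l * (\<Prod>k=l..<N. x + of_nat k)"
    unfolding pochhammer_prod using assms(1) by (simp add: prod.atLeastLessThan_concat)
  then show ?thesis
    using assms(2) by simp
qed

lemma prod_double: "(\<Prod>k=l..<l+d. 2 * f k) = 2 ^ d * (\<Prod>k=l..<l+d. f k :: complex)"
  by (simp add: prod.distrib)

text \<open>Writing the upper index as \<open>l + d\<close> avoids truncated subtraction. The
  product contributes \<open>2 ^ d\<close>, which merges with \<open>(- 2) ^ d\<close> and the sign
  of the top coefficient into \<open>(- 1) ^ l * 4 ^ d\<close>. For \<open>d = 0\<close> the formula
  returns the separately defined top coefficient.\<close>

lemma geg_a_eq: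
  assumes "\<And>k. 2 * \<nu> - 4 * of_nat (l + d) + 2 * of_nat k + of_nat n + 1 = 2 * f k"
  shows "geg_a n (l + d) l \<nu> =
    (- 1) ^ l * 4 ^ d * fact (l + d) / (fact l * fact (2 * d)) * (\<Prod>k=l..<l+d. f k)"
proof -
  have "(- 2) ^ d * 2 ^ d * (- 1) ^ (l + d) = (- 1) ^ l * (4 :: complex) ^ d"
    by (simp add: power_add power_mult_distrib[symmetric])
  then show ?thesis
    unfolding geg_a_def assms prod_double by (simp add: algebra_simps)
qed

lemma geg_b_eq:
  assumes "\<And>k. 2 * \<nu> - 4 * of_nat (l + d) + 2 * of_nat k + of_nat n - 1 = 2 * f k"
  shows "geg_b n (l + d) l \<nu> =
    (- 1) ^ l * 4 ^ d * fact (l + d) / (fact l * fact (2 * d + 1)) * (\<Prod>k=l..<l+d. f k)"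
proof -
  have "(- 2) ^ d * 2 ^ d * (- 1) ^ (l + d) = (- 1) ^ l * (4 :: complex) ^ d"
    by (simp add: power_add power_mult_distrib[symmetric])
  then show ?thesis
    unfolding geg_b_def assms prod_double by (simp add: algebra_simps)
qed

text \<open>The condition \<open>\<mu> + n/2 - M + k \<noteq> 0\<close> in the lemmas below keeps \<open>\<mu>\<close> away from the zeros of the
  Pochhammer symbol in \<open>sol_coeff\<close>, where division by zero makes \<open>delta_coeff\<close> meaningless.\<close>

definition delta_coeff :: "nat \<Rightarrow> nat \<Rightarrow> nat \<Rightarrow> complex \<Rightarrow> complex" where
  "delta_coeff n M j \<mu> =
     res_prefactor n M \<mu> * (1 / fact (M - j)) * sol_coeff j (\<mu> + (of_nat n - 1) / 2 - of_nat M)"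

lemma delta_coeff_even_even:
  assumes "l \<le> N" and "\<And>k. k \<le> N \<Longrightarrow> \<mu> + of_nat n / 2 - of_nat (2 * N) + of_nat k \<noteq> 0"
  shows "delta_coeff n (2 * N) (2 * l) \<mu> = (- 1) ^ l * geg_a n N l (\<mu> - 1/2)"
proof -
  \<comment> \<open>Since 1/2 + (n - 1)/2 = n/2, this is both the base of the Pochhammer symbol in
    \<open>sol_coeff\<close> and the first factor of the residue prefactor.\<close>
  define x where "x = \<mu> + of_nat n / 2 - of_nat (2 * N)"
  obtain d where N: "N = l + d"
    using assms(1) le_Suc_ex by blast
  have nz: "pochhammer x l \<noteq> 0"
    using assms by (auto simp: pochhammer_prod x_def)
  have "delta_coeff n (2 * N) (2 * l) \<mu> =
      2 ^ (2 * N) * fact N * pochhammer x N / fact (2 * N - 2 * l) / (2 ^ (2 * l) * fact l * pochhammer x l)"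
    by (simp add: delta_coeff_def res_prefactor_def sol_coeff_def pochhammer_prod x_def
        atLeast0LessThan diff_divide_distrib add_divide_distrib algebra_simps)
  also have "\<dots> = 2 ^ (2 * N) / 2 ^ (2 * l) * fact N / (fact l * fact (2 * N - 2 * l)) *
      (pochhammer x N / pochhammer x l)"
    by simp
  also have "\<dots> = 4 ^ d * fact N / (fact l * fact (2 * d)) * (\<Prod>k=l..<N. x + of_nat k)"
    unfolding pochhammer_ratio[OF assms(1) nz] by (simp add: N power_add power_mult)
  \<comment> \<open>At the argument \<open>\<mu> - 1/2\<close> the \<open>k\<close>-th Gegenbauer
    factor is \<open>2 * (x + of_nat k)\<close>.\<close>
  also have "\<dots> = (- 1) ^ l * geg_a n N l (\<mu> - 1/2)"
    unfolding N by (subst geg_a_eq[where f = "\<lambda>k. x + of_nat k"])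
      (simp_all add: x_def N field_simps flip: power_mult_distrib)
  finally show ?thesis .
qed

text \<open>The odd solution operator cancels one more factor, so the tail starts at
  \<open>l + 1\<close>; shifting the index by one gives the product in the coefficient of order
  \<open>N - 1\<close>. The factor \<open>2 * of_nat N\<close> consists of a surplus power of 2 and
  of \<open>fact N = N * fact (N - 1)\<close>.\<close>

lemma delta_coeff_even_odd:
  assumes "l < N" and "\<And>k. k \<le> N \<Longrightarrow> \<mu> + of_nat n / 2 - of_nat (2 * N) + of_nat k \<noteq> 0"
  shows "delta_coeff n (2 * N) (2 * l + 1) \<mu> = (- 1) ^ l * (2 * of_nat N) * geg_b n (N - 1) l (\<mu> - 1/2)"
proof -
  define x where "x = \<mu> + of_nat n / 2 - of_nat (2 * N)"
  obtain d where N: "N = Suc (l + d)"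
    using assms(1) less_imp_Suc_add by blast
  have nz: "pochhammer x (l + 1) \<noteq> 0"
    using assms by (auto simp: pochhammer_prod x_def)
  have "delta_coeff n (2 * N) (2 * l + 1) \<mu> =
      2 ^ (2 * N) * fact N * pochhammer x N / fact (2 * N - (2 * l + 1)) /
        (2 ^ (2 * l + 1) * fact l * pochhammer x (l + 1))"
    by (simp add: delta_coeff_def res_prefactor_def sol_coeff_def pochhammer_prod x_def
        atLeast0LessThan diff_divide_distrib add_divide_distrib algebra_simps)
  also have "\<dots> = 2 ^ (2 * N) / 2 ^ (2 * l + 1) * fact N / (fact l * fact (2 * N - (2 * l + 1))) *
      (pochhammer x N / pochhammer x (l + 1))"
    by (simp add: mult_ac)
  also have "2 * N - (2 * l + 1) = 2 * d + 1"
    by (simp add: N)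
  also have "pochhammer x N / pochhammer x (l + 1) = (\<Prod>k=l..<l+d. x + of_nat k + 1)"
    using assms(1) unfolding pochhammer_ratio[OF Suc_leI[OF assms(1), simplified Suc_eq_plus1] nz]
    by (simp add: N prod.shift_bounds_Suc_ivl add_ac del: prod.op_ivl_Suc)
  also have "2 ^ (2 * N) / 2 ^ (2 * l + 1) = (2 :: complex) * 4 ^ d"
    by (simp add: N power_add power_mult)
  also have "2 * 4 ^ d * fact N / (fact l * fact (2 * d + 1)) * (\<Prod>k=l..<l+d. x + of_nat k + 1)
      = (- 1) ^ l * (2 * of_nat N) * geg_b n (N - 1) l (\<mu> - 1/2)"
    unfolding N diff_Suc_1 by (subst geg_b_eq[where f = "\<lambda>k. x + of_nat k + 1"])
      (simp_all add: x_def N field_simps flip: power_mult_distrib)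
  finally show ?thesis .
qed

text \<open>The odd prefactor has \<open>N + 1\<close> factors. The last one,
  \<open>x + of_nat N\<close>, survives outside the Gegenbauer product, and with a surplus 2 it
  becomes \<open>c_coeff n N \<mu>\<close>.\<close>

lemma delta_coeff_odd_even:
  assumes "l \<le> N" and "\<And>k. k \<le> N \<Longrightarrow> \<mu> + of_nat n / 2 - of_nat (2 * N + 1) + of_nat k \<noteq> 0"
  shows "delta_coeff n (2 * N + 1) (2 * l) \<mu> = (- 1) ^ l * geg_b n N l (\<mu> - 1/2) * c_coeff n N \<mu>"
proof -
  define x where "x = \<mu> + of_nat n / 2 - of_nat (2 * N + 1)"
  obtain d where N: "N = l + d"
    using assms(1) le_Suc_ex by blast
  have nz: "pochhammer x l \<noteq> 0"
    using assms by (auto simp: pochhammer_prod x_def)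
  have le: "l \<le> N + 1"
    using assms(1) by simp
  have c: "c_coeff n N \<mu> = 2 * (x + of_nat N)"
    by (simp add: c_coeff_def x_def)
  have "delta_coeff n (2 * N + 1) (2 * l) \<mu> =
      2 ^ (2 * N + 1) * fact N * pochhammer x (N + 1) / fact (2 * N + 1 - 2 * l) /
        (2 ^ (2 * l) * fact l * pochhammer x l)"
    by (simp add: delta_coeff_def res_prefactor_def sol_coeff_def pochhammer_prod x_def
        atLeast0LessThan lessThan_Suc_atMost diff_divide_distrib add_divide_distrib algebra_simps
        del: prod.lessThan_Suc prod.op_ivl_Suc)
  also have "\<dots> = 2 ^ (2 * N + 1) / 2 ^ (2 * l) * fact N / (fact l * fact (2 * N + 1 - 2 * l)) *
      (pochhammer x (N + 1) / pochhammer x l)"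
    by simp
  also have "2 * N + 1 - 2 * l = 2 * d + 1"
    by (simp add: N)
  also have "pochhammer x (N + 1) / pochhammer x l = (\<Prod>k=l..<l+d. x + of_nat k) * (x + of_nat N)"
    unfolding pochhammer_ratio[OF le nz] by (simp add: N)
  also have "2 ^ (2 * N + 1) / 2 ^ (2 * l) = (2 :: complex) * 4 ^ d"
    by (simp add: N power_add power_mult)
  also have "2 * 4 ^ d * fact N / (fact l * fact (2 * d + 1)) *
      ((\<Prod>k=l..<l+d. x + of_nat k) * (x + of_nat N))
      = (- 1) ^ l * geg_b n N l (\<mu> - 1/2) * c_coeff n N \<mu>"
    unfolding c unfolding N by (subst geg_b_eq[where f = "\<lambda>k. x + of_nat k"])
      (simp_all add: x_def N field_simps flip: power_mult_distrib)
  finally show ?thesis .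
qed

text \<open>Here \<open>N + 1\<close> factors are divided by the first \<open>l + 1\<close>. The
  remaining tail, shifted by one, has factors \<open>x + of_nat k + 1\<close>, which undo the extra
  - 1 in \<open>x\<close> and so fit \<open>geg_a\<close>.\<close>

lemma delta_coeff_odd_odd:
  assumes "l \<le> N" and "\<And>k. k \<le> N \<Longrightarrow> \<mu> + of_nat n / 2 - of_nat (2 * N + 1) + of_nat k \<noteq> 0"
  shows "delta_coeff n (2 * N + 1) (2 * l + 1) \<mu> = (- 1) ^ l * geg_a n N l (\<mu> - 1/2)"
proof -
  define x where "x = \<mu> + of_nat n / 2 - of_nat (2 * N + 1)"
  obtain d where N: "N = l + d"
    using assms(1) le_Suc_ex by blast
  have nz: "pochhammer x (l + 1) \<noteq> 0"
    using assms by (auto simp: pochhammer_prod x_def)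
  have le: "l + 1 \<le> N + 1"
    using assms(1) by simp
  have "delta_coeff n (2 * N + 1) (2 * l + 1) \<mu> =
      2 ^ (2 * N + 1) * fact N * pochhammer x (N + 1) / fact (2 * N + 1 - (2 * l + 1)) /
        (2 ^ (2 * l + 1) * fact l * pochhammer x (l + 1))"
    by (simp add: delta_coeff_def res_prefactor_def sol_coeff_def pochhammer_prod x_def
        atLeast0LessThan lessThan_Suc_atMost diff_divide_distrib add_divide_distrib algebra_simps
        del: prod.lessThan_Suc prod.op_ivl_Suc)
  also have "\<dots> = 2 ^ (2 * N + 1) / 2 ^ (2 * l + 1) * fact N / (fact l * fact (2 * N + 1 - (2 * l + 1))) *
      (pochhammer x (N + 1) / pochhammer x (l + 1))"
    by (simp add: mult_ac)
  also have "2 * N + 1 - (2 * l + 1) = 2 * d"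
    by (simp add: N)
  also have "pochhammer x (N + 1) / pochhammer x (l + 1) = (\<Prod>k=l..<l+d. x + of_nat k + 1)"
    unfolding pochhammer_ratio[OF le nz]
    by (simp add: N prod.shift_bounds_Suc_ivl add_ac del: prod.op_ivl_Suc)
  also have "2 ^ (2 * N + 1) / 2 ^ (2 * l + 1) = (4 :: complex) ^ d"
    by (simp add: N power_add power_mult)
  also have "4 ^ d * fact N / (fact l * fact (2 * d)) * (\<Prod>k=l..<l+d. x + of_nat k + 1)
      = (- 1) ^ l * geg_a n N l (\<mu> - 1/2)"
    unfolding N by (subst geg_a_eq[where f = "\<lambda>k. x + of_nat k + 1"])
      (simp_all add: x_def N field_simps flip: power_mult_distrib)
  finally show ?thesis .
qed

section \<open>Polynomial continuation\<close>

lemma tendsto_smult: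
  fixes f :: "'a \<Rightarrow> complex" and g :: "'a \<Rightarrow> complex^'d"
  assumes "(f \<longlongrightarrow> a) F" and "(g \<longlongrightarrow> b) F"
  shows "((\<lambda>x. f x *s g x) \<longlongrightarrow> a *s b) F"
  by (rule vec_tendstoI) (use assms in \<open>auto intro!: tendsto_intros\<close>)

lemma tendsto_matrix_vector_mult:
  fixes A :: "complex^'d^'c"
  shows "(g \<longlongrightarrow> b) F \<Longrightarrow> ((\<lambda>x. A *v g x) \<longlongrightarrow> A *v b) F"
  by (rule bounded_linear.tendsto[OF matrix_vector_mul_bounded_linear])

lemma tendsto_geg_a: "((\<lambda>\<mu>. geg_a n N j (\<mu> - 1/2)) \<longlongrightarrow> geg_a n N j (\<nu> - 1/2)) (at \<nu>)"
  by (cases "j = N") (auto simp: geg_a_def intro!: tendsto_intros)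

lemma tendsto_geg_b: "((\<lambda>\<mu>. geg_b n N j (\<mu> - 1/2)) \<longlongrightarrow> geg_b n N j (\<nu> - 1/2)) (at \<nu>)"
  by (cases "j = N") (auto simp: geg_b_def simp del: fact_Suc intro!: tendsto_intros)

lemma tendsto_c_coeff: "(c_coeff n N \<longlongrightarrow> c_coeff n N \<nu>) (at \<nu>)"
  unfolding c_coeff_def[abs_def] by (auto intro!: tendsto_intros)

lemma sum_split_parity: "(\<Sum>j<2 * N. f j) = (\<Sum>j<N. f (2 * j)) + (\<Sum>j<N. f (2 * j + 1))"
  for f :: "nat \<Rightarrow> 'a::comm_monoid_add"
  by (induction N) (simp_all add: algebra_simps)

lemma delta_op_eq_sum:
  "res_prefactor n M \<mu> *s delta_op e M (\<mu> + (of_nat n - 1) / 2 - of_nat M) \<psi> y =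
    (\<Sum>j\<le>M. delta_coeff n M j \<mu> *s
      (D_tilde e ^^ j) (restrict_bdry ((normal_deriv ^^ (M - j)) \<psi>)) y)"
  by (simp add: delta_op_def sol_op_def delta_coeff_def vec.scale_sum_right vector_smult_assoc mult.assoc)

text \<open>The condition excludes only finitely many \<open>\<mu>\<close>, so the coefficient
  identity holds on a punctured neighbourhood of any \<open>\<nu>\<close>. Convergence of
  \<open>R\<close> at \<open>\<nu>\<close> then determines the limit that defines
  \<open>D_res\<close>, whether or not \<open>\<nu>\<close> is a pole.\<close>

lemma D_res_eqI:
  assumes "(R \<longlongrightarrow> R \<nu>) (at \<nu>)"
    and "\<And>\<mu>. (\<And>k. k \<le> M \<Longrightarrow> \<mu> + of_nat CARD('m option) / 2 - of_nat M + of_nat k \<noteq> 0) \<Longrightarrow>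
      (\<Sum>j\<le>M. delta_coeff CARD('m option) M j \<mu> *s
        (D_tilde e ^^ j) (restrict_bdry ((normal_deriv ^^ (M - j)) \<psi>)) y) = R \<mu>"
  shows "D_res (e :: 'm::finite option \<Rightarrow> complex^'d^'d) M \<nu> \<psi> y = R \<nu>"
proof -
  have "\<forall>\<^sub>F \<mu> in at \<nu>. \<forall>k\<in>{..M}. \<mu> \<noteq> - (of_nat CARD('m option) / 2 - of_nat M + of_nat k)"
    by (intro eventually_ball_finite finite_atMost ballI eventually_neq_at_within)
  then have "\<forall>\<^sub>F \<mu> in at \<nu>. R \<mu> = res_prefactor CARD('m option) M \<mu> *s
      delta_op e M (\<mu> + (of_nat CARD('m option) - 1) / 2 - of_nat M) \<psi> y"
  proof eventually_elim
    case (elim \<mu>)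
    have "\<mu> + of_nat CARD('m option) / 2 - of_nat M + of_nat k \<noteq> 0" if "k \<le> M" for k
      using elim that by (auto simp only: eq_neg_iff_add_eq_0 add_diff_eq add.assoc[symmetric] atMost_iff)
    then show ?case
      unfolding delta_op_eq_sum by (rule assms(2)[symmetric])
  qed
  then have "((\<lambda>\<mu>. res_prefactor CARD('m option) M \<mu> *s
      delta_op e M (\<mu> + (of_nat CARD('m option) - 1) / 2 - of_nat M) \<psi> y) \<longlongrightarrow> R \<nu>) (at \<nu>)"
    by (rule Lim_transform_eventually[OF assms(1)])
  then show ?thesis
    unfolding D_res_def Let_def by (intro tendsto_Lim) auto
qed

section \<open>Assembly of the even and odd residue families\<close>

theorem theorem3p7:
  fixes e :: "'m::finite option \<Rightarrow> complex^'d^'d"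
    and \<psi> :: "real^('m option) \<Rightarrow> complex^'d"
    and n N :: nat and \<nu> :: complex
  assumes "n = CARD('m option)"
    and "complex_spinor_module e"
    and "smooth_on half_space \<psi>"
  shows
   "D_res e (2 * N) \<nu> \<psi> = (\<lambda>y. (- 1) ^ N *s
          ((\<Sum>j\<le>N. geg_a n N j (\<nu> - 1/2) *s
              (D_T e ^^ (2 * j)) (restrict_bdry ((D_N e ^^ (2 * N - 2 * j)) \<psi>)) y) +
           (2 * of_nat N) *s
           (\<Sum>j<N. geg_b n (N - 1) j (\<nu> - 1/2) *s
              (D_T e ^^ (2 * j + 1)) (restrict_bdry ((D_N e ^^ (2 * N - 2 * j - 1)) \<psi>)) y))) \<and>
    D_res e (2 * N + 1) \<nu> \<psi> = (\<lambda>y. (- 1) ^ (N + 1) *s (e None *v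
          ((\<Sum>j\<le>N. (geg_b n N j (\<nu> - 1/2) * c_coeff n N \<nu>) *s
              (D_T e ^^ (2 * j)) (restrict_bdry ((D_N e ^^ (2 * N - 2 * j + 1)) \<psi>)) y) -
           (\<Sum>j\<le>N. geg_a n N j (\<nu> - 1/2) *s
              (D_T e ^^ (2 * j + 1)) (restrict_bdry ((D_N e ^^ (2 * N - 2 * j)) \<psi>)) y))))"
proof (intro conjI ext)
  note DN = funpow_D_T_restrict_even[OF assms(2,3)] funpow_D_T_restrict_odd[OF assms(2,3)]
  note Dt = funpow_D_tilde_even[OF assms(2)] funpow_D_tilde_odd[OF assms(2)]
  note sm = smooth_on_restrict_bdry[OF smooth_on_funpow_partial[OF assms(3)]]
  note lims = tendsto_intros tendsto_smult tendsto_matrix_vector_mult tendsto_geg_a tendsto_geg_b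
    tendsto_c_coeff
  fix y
  show "D_res e (2 * N) \<nu> \<psi> y = (- 1) ^ N *s
          ((\<Sum>j\<le>N. geg_a n N j (\<nu> - 1/2) *s
              (D_T e ^^ (2 * j)) (restrict_bdry ((D_N e ^^ (2 * N - 2 * j)) \<psi>)) y) +
           (2 * of_nat N) *s
           (\<Sum>j<N. geg_b n (N - 1) j (\<nu> - 1/2) *s
              (D_T e ^^ (2 * j + 1)) (restrict_bdry ((D_N e ^^ (2 * N - 2 * j - 1)) \<psi>)) y))"
    (is "_ = ?R \<nu>")
  proof (rule D_res_eqI[where R = ?R])
    show "(?R \<longlongrightarrow> ?R \<nu>) (at \<nu>)"
      by (intro lims)
    fix \<mu> :: complex
    assume "\<And>k. k \<le> 2 * N \<Longrightarrow> \<mu> + of_nat CARD('m option) / 2 - of_nat (2 * N) + of_nat k \<noteq> 0"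
    then have nz: "\<And>k. k \<le> N \<Longrightarrow> \<mu> + of_nat n / 2 - of_nat (2 * N) + of_nat k \<noteq> 0"
      unfolding assms(1) by simp
    let ?f = "\<lambda>j. delta_coeff n (2 * N) j \<mu> *s
        (D_tilde e ^^ j) (restrict_bdry ((normal_deriv ^^ (2 * N - j)) \<psi>)) y"
    have ev: "?f (2 * j) = (- 1) ^ N *s (geg_a n N j (\<mu> - 1/2) *s
        (D_T e ^^ (2 * j)) (restrict_bdry ((D_N e ^^ (2 * N - 2 * j)) \<psi>)) y)" if "j \<le> N" for j
    proof -
      have k: "2 * N - 2 * j = 2 * (N - j)"
        by simp
      \<comment> \<open>The outer sign times the sign from \<open>D_N\<close> to the power
        \<open>2 * (N - j)\<close> must match the sign in
        \<open>delta_coeff_even_even\<close>.\<close>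
      have s: "(- 1) ^ N * (- 1) ^ (N - j) = (- 1 :: complex) ^ j"
        using that by (simp add: minus_one_power_iff)
      have dc: "delta_coeff n (2 * N) (2 * j) \<mu> = (- 1) ^ j * geg_a n N j (\<mu> - 1/2)"
        by (rule delta_coeff_even_even[OF that nz])
      show ?thesis
        unfolding dc Dt(1)[OF sm] k DN
        by (simp only: vector_smult_assoc s[symmetric] mult_ac)
    qed
    have od: "?f (2 * j + 1) = (- 1) ^ N *s ((2 * of_nat N) *s (geg_b n (N - 1) j (\<mu> - 1/2) *s
        (D_T e ^^ (2 * j + 1)) (restrict_bdry ((D_N e ^^ (2 * N - 2 * j - 1)) \<psi>)) y))" if "j < N" for j
    proof -
      \<comment> \<open>The bound \<open>j < N\<close> keeps these subtractions from truncating; for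
        \<open>N = 0\<close> the range is empty, so \<open>N - 1\<close> does no harm.\<close>
      have k: "2 * N - (2 * j + 1) = 2 * (N - 1 - j) + 1" "2 * N - 2 * j - 1 = 2 * (N - 1 - j) + 1"
        using that by auto
      \<comment> \<open>Both sides carry one \<open>e None\<close>: from the odd power of
        \<open>D_tilde\<close> on the left, from the odd power of \<open>D_N\<close> on the right.
        Moving the latter past \<open>2 * j + 1\<close> tangential operators adds that
        exponent.\<close>
      have s: "(- 1) ^ N * (- 1) ^ (N - 1 - j + (2 * j + 1)) = (- 1 :: complex) ^ j"
        using that by (auto simp: minus_one_power_iff)
      have dc: "delta_coeff n (2 * N) (2 * j + 1) \<mu> =
          (- 1) ^ j * (2 * of_nat N) * geg_b n (N - 1) j (\<mu> - 1/2)"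
        by (rule delta_coeff_even_odd[OF that nz])
      show ?thesis
        unfolding dc Dt(2)[OF sm] k DN
        by (simp only: vector_smult_assoc s[symmetric] mult_ac)
    qed
    \<comment> \<open>There are \<open>2 * N + 1\<close> terms, so the top even one is split off
      before pairing by parity and then rejoins the even sum.\<close>
    have "(\<Sum>j\<le>2 * N. ?f j) = (\<Sum>j<2 * N. ?f j) + ?f (2 * N)"
      by (simp only: lessThan_Suc_atMost[symmetric] sum.lessThan_Suc)
    also have "\<dots> = (\<Sum>j\<le>N. ?f (2 * j)) + (\<Sum>j<N. ?f (2 * j + 1))"
      unfolding sum_split_parity lessThan_Suc_atMost[symmetric] sum.lessThan_Suc by (simp add: ac_simps)
    also have "\<dots> = ?R \<mu>"
      using ev od by (simp add: vec.scale_sum_right vec.scale_right_distrib del: funpow.simps)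
    finally show "(\<Sum>j\<le>2 * N. delta_coeff CARD('m option) (2 * N) j \<mu> *s
        (D_tilde e ^^ j) (restrict_bdry ((normal_deriv ^^ (2 * N - j)) \<psi>)) y) = ?R \<mu>"
      unfolding assms(1) .
  qed
  show "D_res e (2 * N + 1) \<nu> \<psi> y = (- 1) ^ (N + 1) *s (e None *v
          ((\<Sum>j\<le>N. (geg_b n N j (\<nu> - 1/2) * c_coeff n N \<nu>) *s
              (D_T e ^^ (2 * j)) (restrict_bdry ((D_N e ^^ (2 * N - 2 * j + 1)) \<psi>)) y) -
           (\<Sum>j\<le>N. geg_a n N j (\<nu> - 1/2) *s
              (D_T e ^^ (2 * j + 1)) (restrict_bdry ((D_N e ^^ (2 * N - 2 * j)) \<psi>)) y)))"
    (is "_ = ?R \<nu>")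
  proof (rule D_res_eqI[where R = ?R])
    show "(?R \<longlongrightarrow> ?R \<nu>) (at \<nu>)"
      by (intro lims)
    fix \<mu> :: complex
    assume "\<And>k. k \<le> 2 * N + 1 \<Longrightarrow> \<mu> + of_nat CARD('m option) / 2 - of_nat (2 * N + 1) + of_nat k \<noteq> 0"
    then have nz: "\<And>k. k \<le> N \<Longrightarrow> \<mu> + of_nat n / 2 - of_nat (2 * N + 1) + of_nat k \<noteq> 0"
      unfolding assms(1) by simp
    let ?f = "\<lambda>j. delta_coeff n (2 * N + 1) j \<mu> *s
        (D_tilde e ^^ j) (restrict_bdry ((normal_deriv ^^ (2 * N + 1 - j)) \<psi>)) y"
    have ev: "?f (2 * j) = (- 1) ^ (N + 1) *s (e None *v ((geg_b n N j (\<mu> - 1/2) * c_coeff n N \<mu>) *s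
        (D_T e ^^ (2 * j)) (restrict_bdry ((D_N e ^^ (2 * N - 2 * j + 1)) \<psi>)) y))" if "j \<le> N" for j
    proof -
      have k: "2 * N + 1 - 2 * j = 2 * (N - j) + 1" "2 * N - 2 * j + 1 = 2 * (N - j) + 1"
        using that by auto
      \<comment> \<open>The last factor - 1 is the square of \<open>e None\<close>: the outer one
        meets the one left over from the odd power of \<open>D_N\<close>, while the even power of
        \<open>D_tilde\<close> has none.\<close>
      have s: "(- 1) ^ (N + 1) * (- 1) ^ (N - j + 2 * j) * (- 1) = (- 1 :: complex) ^ j"
        using that by (auto simp: minus_one_power_iff)
      have dc: "delta_coeff n (2 * N + 1) (2 * j) \<mu> =
          (- 1) ^ j * geg_b n N j (\<mu> - 1/2) * c_coeff n N \<mu>"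
        by (rule delta_coeff_odd_even[OF that nz])
      show ?thesis
        unfolding dc Dt(1)[OF sm] k DN
        by (simp only: vector_scalar_commute vector_smult_assoc clifford_square[OF assms(2)]
            vector_sneg_minus1 s[symmetric] mult_ac)
    qed
    have od: "?f (2 * j + 1) = - ((- 1) ^ (N + 1) *s (e None *v (geg_a n N j (\<mu> - 1/2) *s
        (D_T e ^^ (2 * j + 1)) (restrict_bdry ((D_N e ^^ (2 * N - 2 * j)) \<psi>)) y)))" if "j \<le> N" for j
    proof -
      have k: "2 * N + 1 - (2 * j + 1) = 2 * (N - j)" "2 * N - 2 * j = 2 * (N - j)"
        by auto
      \<comment> \<open>The leading - 1 is the minus sign before the second sum. The outer
        \<open>e None\<close> stays and matches the one from the odd power of
        \<open>D_tilde\<close>.\<close>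
      have s: "- 1 * ((- 1) ^ (N + 1) * (- 1) ^ (N - j)) = (- 1 :: complex) ^ j"
        using that by (auto simp: minus_one_power_iff)
      have dc: "delta_coeff n (2 * N + 1) (2 * j + 1) \<mu> = (- 1) ^ j * geg_a n N j (\<mu> - 1/2)"
        by (rule delta_coeff_odd_odd[OF that nz])
      show ?thesis
        unfolding dc Dt(2)[OF sm] k DN
        by (simp only: vector_scalar_commute vector_smult_assoc vector_sneg_minus1 s[symmetric] mult_ac)
    qed
    \<comment> \<open>The number of terms, \<open>2 * (N + 1)\<close>, is even, so the parity split
      leaves no term over.\<close>
    have "(\<Sum>j\<le>2 * N + 1. ?f j) = (\<Sum>j<2 * (N + 1). ?f j)"
      by (rule sum.cong) auto
    also have "\<dots> = (\<Sum>j\<le>N. ?f (2 * j)) + (\<Sum>j\<le>N. ?f (2 * j + 1))"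
      unfolding sum_split_parity by (simp only: Suc_eq_plus1[symmetric] lessThan_Suc_atMost)
    also have "\<dots> = ?R \<mu>"
      using ev od by (simp add: vec.scale_sum_right vec.scale_right_diff_distrib
          matrix_vector_mult_diff_distrib linear_sum[OF matrix_vector_mul_linear] sum_negf del: funpow.simps)
    finally show "(\<Sum>j\<le>2 * N + 1. delta_coeff CARD('m option) (2 * N + 1) j \<mu> *s
        (D_tilde e ^^ j) (restrict_bdry ((normal_deriv ^^ (2 * N + 1 - j)) \<psi>)) y) = ?R \<mu>"
      unfolding assms(1) .
  qed
qed

end
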